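(* Let $\mathcal{A}\in\mathbb{C}^{n_1\times n_2\times n_3}$. Then there exist a unitary tensor $\mathcal{Q}\in\mathbb{C}^{n_1\times n_1\times n_3}$ and an F-upper tensor $\mathcal{R}\in\mathbb{C}^{n_1\times n_2\times n_3}$ such that $$\mathcal{A}=\mathcal{Q}*_c\mathcal{R}.$$
   Context: For a third-order tensor $\mathcal{A}\in\mathbb{C}^{n_1\times n_2\times n_3}$, $\mathcal{A}^{(i)}=\mathcal{A}(:,:,i)\in\mathbb{C}^{n_1\times n_2}$ denotes its $i$-th frontal slice. Let $\mathbf{C}_{n_3}$ be the $n_3\times n_3$ orthogonal DCT matrix, with entries $(\mathbf{C}_{n_3})_{jk}=\sqrt{(2-\delta_{j1})/n_3}\,\cos\big(\tfrac{(j-1)(2k-1)\pi}{2n_3}\big)$; let $\mathbf{W}$ be the diagonal matrix whose diagonal is the first column of $\mathbf{C}_{n_3}$; let $\mathbf{Z}$ be the $n_3\times n_3$ matrix with ones on the first superdiagonal and zeros elsewhere; and put $\mathbf{M}=\mathbf{W}^{-1}\mathbf{C}_{n_3}(\mathbf{I}+\mathbf{Z})$, an invertible matrix. Define the linear bijection $L$ on tensors with third dimension $n_3$ by $L(\mathcal{A})_{ijk}=\sum_{l=1}^{n_3}\mathbf{M}_{kl}\mathcal{A}_{ijl}$. The C-product of $\mathcal{A}\in\mathbb{C}^{n_1\times n_2\times n_3}$ and $\mathcal{B}\in\mathbb{C}^{n_2\times l\times n_3}$ is the tensor $\mathcal{A}*_c\mathcal{B}\in\mathbb{C}^{n_1\times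 l\times n_3}$ determined by $L(\mathcal{A}*_c\mathcal{B})^{(i)}=L(\mathcal{A})^{(i)}L(\mathcal{B})^{(i)}$, $i=1,\dots,n_3$. The conjugate transpose $\mathcal{A}^H$ is determined by $L(\mathcal{A}^H)^{(i)}=(L(\mathcal{A})^{(i)})^H$ for all $i$. The identity tensor $\mathcal{I}\in\mathbb{C}^{n\times n\times n_3}$ is determined by $L(\mathcal{I})^{(i)}=\mathbf{I}_n$ for all $i$. A tensor $\mathcal{Q}\in\mathbb{C}^{n\times n\times n_3}$ is unitary if $\mathcal{Q}^H*_c\mathcal{Q}=\mathcal{Q}*_c\mathcal{Q}^H=\mathcal{I}$. A tensor is F-upper if all its frontal slices are upper triangular matrices. *)

theory Defs
  imports
    Complex_Main
    "Jordan_Normal_Form.Matrix"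
    "Jordan_Normal_Form.Gauss_Jordan_Elimination"
    "Jordan_Normal_Form.Schur_Decomposition"
begin

text \<open>
  A third-order tensor is represented by the list of its frontal slices, so that \<open>A ! k $$ (i, j)\<close>
  is the entry in position \<open>(i + 1, j + 1, k + 1)\<close>: all indices are shifted to start at 0.
\<close>

type_synonym tensor = "complex mat list"

definition tensors :: "nat \<Rightarrow> nat \<Rightarrow> nat \<Rightarrow> tensor set" where
  "tensors n1 n2 n3 = {A. length A = n3 \<and> set A \<subseteq> carrier_mat n1 n2}"

text \<open>All slices have the same size, so the first two dimensions can be read off the first slice.\<close>

definition tdim1 :: "tensor \<Rightarrow> nat" where "tdim1 A = dim_row (A ! 0)"
definition tdim2 :: "tensor \<Rightarrow> nat" where "tdim2 A = dim_col (A ! 0)"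

text \<open>With 0-based \<open>j\<close> and \<open>k\<close>, the angle \<open>(j-1)(2k-1)\<pi>/(2n)\<close> becomes \<open>j(2k+1)\<pi>/(2n)\<close>.\<close>

definition dct_mat :: "nat \<Rightarrow> complex mat" where
  "dct_mat n = mat n n (\<lambda>(j, k). complex_of_real
     (sqrt ((2 - (if j = 0 then 1 else 0)) / real n) *
      cos (real j * (2 * real k + 1) * pi / (2 * real n))))"

definition W_mat :: "nat \<Rightarrow> complex mat" where
  "W_mat n = mat_diag n (\<lambda>j. dct_mat n $$ (j, 0))"

definition Z_mat :: "nat \<Rightarrow> complex mat" where
  "Z_mat n = mat n n (\<lambda>(i, j). if j = i + 1 then 1 else 0)"

definition M_mat :: "nat \<Rightarrow> complex mat" where
  "M_mat n = the (mat_inverse (W_mat n)) * dct_mat n * (1\<^sub>m n + Z_mat n)"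

definition L_map :: "tensor \<Rightarrow> tensor" where
  "L_map A = map (\<lambda>k. mat (tdim1 A) (tdim2 A)
     (\<lambda>(i, j). \<Sum>l<length A. M_mat (length A) $$ (k, l) * A ! l $$ (i, j))) [0..<length A]"

text \<open>
  The next three notions are specified through their images under \<open>L_map\<close>; the descriptions
  are unique because \<open>M_mat n\<close> is invertible.
\<close>

definition c_product :: "tensor \<Rightarrow> tensor \<Rightarrow> tensor" (infixl "*\<^sub>c" 70) where
  "A *\<^sub>c B = (THE C. C \<in> tensors (tdim1 A) (tdim2 B) (length A) \<and>
     (\<forall>i<length A. L_map C ! i = L_map A ! i * L_map B ! i))"

definition conj_transpose :: "tensor \<Rightarrow> tensor" where
  "conj_transpose A = (THE B. B \<in> tensors (tdim2 A) (tdim1 A) (length A) \<and>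
     (\<forall>i<length A. L_map B ! i = mat_adjoint (L_map A ! i)))"

definition identity_tensor :: "nat \<Rightarrow> nat \<Rightarrow> tensor" where
  "identity_tensor n n3 = (THE B. B \<in> tensors n n n3 \<and> (\<forall>i<n3. L_map B ! i = 1\<^sub>m n))"

definition unitary_tensor :: "nat \<Rightarrow> nat \<Rightarrow> tensor \<Rightarrow> bool" where
  "unitary_tensor n n3 Q \<longleftrightarrow> Q \<in> tensors n n n3 \<and>
     conj_transpose Q *\<^sub>c Q = identity_tensor n n3 \<and>
     Q *\<^sub>c conj_transpose Q = identity_tensor n n3"

text \<open>
  The library's \<open>upper_triangular\<close> is meant for square matrices: on a matrix with more rows than
  columns it also constrains positions outside the matrix.
\<close>

definition F_upper :: "tensor \<Rightarrow> bool" where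
  "F_upper R \<longleftrightarrow> (\<forall>S\<in>set R. \<forall>i<dim_row S. \<forall>j<dim_col S. j < i \<longrightarrow> S $$ (i, j) = 0)"

end

theory Submission
  imports Defs
begin

text \<open>
  The map \<open>L_map\<close> turns the C-product into the ordinary matrix product of corresponding slices, so
  the decomposition can be computed slice by slice after the transformation and pulled back.

  Pulling back is possible because the matrix \<open>M_mat n\<close> is invertible
  (\<open>M_mat_inverse\<close>): the DCT matrix is orthogonal, the entries of its first column do not vanish, and
  \<open>I + Z\<close> is unit upper triangular. Hence \<open>L_map\<close> is a bijection on the tensors of any fixed size
  (\<open>L_map_inj\<close>, \<open>L_map_surj\<close>), and the tensor operations defined by their images under \<open>L_map\<close>
  are characterised by those images.

  Every slice of \<open>L_map A\<close> has a QR decomposition (\<open>QR_exists\<close>). Let \<open>Q\<close> and \<open>R\<close> be the preimages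
  of the tensors formed by the unitary and by the triangular factors. Then \<open>A = Q *\<^sub>c R\<close> and \<open>Q\<close> is
  unitary by comparing images. The slices of \<open>R\<close> itself are upper triangular because the inverse of
  \<open>L_map\<close> only forms linear combinations of slices, and upper triangular matrices form a linear
  subspace.
\<close>

section \<open>Unitary matrices and the QR decomposition\<close>

lemma mat_adjoint_dim [simp]:
  "dim_row (mat_adjoint A) = dim_col A" "dim_col (mat_adjoint A) = dim_row A"
  unfolding mat_adjoint_def by auto

lemma mat_adjoint_carrier [simp]:
  "A \<in> carrier_mat m n \<Longrightarrow> mat_adjoint A \<in> carrier_mat n m"
  by (auto intro!: carrier_matI)

lemma mat_adjoint_index [simp]:
  fixes A :: "complex mat"
  assumes "i < dim_col A" "j < dim_row A"
  shows "mat_adjoint A $$ (i, j) = cnj (A $$ (j, i))"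
  using assms unfolding mat_adjoint_def by (simp add: mat_of_rows_index)

lemma mat_adjoint_mult:
  fixes A B :: "complex mat"
  assumes A: "A \<in> carrier_mat m k" and B: "B \<in> carrier_mat k n"
  shows "mat_adjoint (A * B) = mat_adjoint B * mat_adjoint A"
  using assms by (intro eq_matI) (auto simp: scalar_prod_def intro!: sum.cong)

lemma mat_adjoint_four_block:
  fixes A B C D :: "complex mat"
  assumes "A \<in> carrier_mat m1 n1" "B \<in> carrier_mat m1 n2"
    "C \<in> carrier_mat m2 n1" "D \<in> carrier_mat m2 n2"
  shows "mat_adjoint (four_block_mat A B C D) =
    four_block_mat (mat_adjoint A) (mat_adjoint C) (mat_adjoint B) (mat_adjoint D)"
  using assms by (intro eq_matI) auto

definition unitary_mat :: "nat \<Rightarrow> complex mat \<Rightarrow> bool" where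
  "unitary_mat n Q \<longleftrightarrow> Q \<in> carrier_mat n n \<and> mat_adjoint Q * Q = 1\<^sub>m n"

lemma unitary_matD:
  assumes "unitary_mat n Q"
  shows "Q \<in> carrier_mat n n" "mat_adjoint Q * Q = 1\<^sub>m n" "Q * mat_adjoint Q = 1\<^sub>m n"
  using assms mat_mult_left_right_inverse[of "mat_adjoint Q" n Q]
  unfolding unitary_mat_def by auto

lemma mat_adjoint_one [simp]: "mat_adjoint (1\<^sub>m n :: complex mat) = 1\<^sub>m n"
  by (rule eq_matI) auto

lemma mat_adjoint_zero [simp]: "mat_adjoint (0\<^sub>m m n :: complex mat) = 0\<^sub>m n m"
  by (rule eq_matI) auto

lemma unitary_mat_one: "unitary_mat n (1\<^sub>m n)"
  unfolding unitary_mat_def by simp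

lemma unitary_mat_mult:
  assumes P: "unitary_mat n P" and Q: "unitary_mat n Q"
  shows "unitary_mat n (P * Q)"
proof -
  note p = unitary_matD[OF P] and q = unitary_matD[OF Q]
  have "mat_adjoint (P * Q) * (P * Q) = mat_adjoint Q * mat_adjoint P * (P * Q)"
    by (simp add: mat_adjoint_mult[OF p(1) q(1)])
  also have "\<dots> = mat_adjoint Q * (mat_adjoint P * (P * Q))"
    by (rule assoc_mult_mat) (use p(1) q(1) in auto)
  also have "mat_adjoint P * (P * Q) = mat_adjoint P * P * Q"
    by (rule assoc_mult_mat[symmetric]) (use p(1) q(1) in auto)
  finally show ?thesis using p q unfolding unitary_mat_def by simp
qed

lemma unitary_mat_block:
  assumes Q: "unitary_mat n Q"
  shows "unitary_mat (Suc n) (four_block_mat (1\<^sub>m 1) (0\<^sub>m 1 n) (0\<^sub>m n 1) Q)" (is "unitary_mat _ ?B")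
proof -
  note q = unitary_matD[OF Q]
  have "mat_adjoint ?B * ?B =
      four_block_mat (1\<^sub>m 1) (0\<^sub>m 1 n) (0\<^sub>m n 1) (mat_adjoint Q) * ?B"
    using q(1) by (subst mat_adjoint_four_block[of _ 1 1 _ n _ n]) auto
  also have "\<dots> = four_block_mat (1\<^sub>m 1) (0\<^sub>m 1 n) (0\<^sub>m n 1) (mat_adjoint Q * Q)"
    by (subst mult_four_block_mat[of _ 1 1 _ n _ n _ _ 1 _ n]) (use q(1) in auto)
  also have "\<dots> = 1\<^sub>m (Suc n)"
    using four_block_one_mat[of 1 n] by (simp add: q(2))
  finally show ?thesis
    using q(1) four_block_carrier_mat[of "1\<^sub>m 1" 1 1 Q n n "0\<^sub>m 1 n" "0\<^sub>m n 1"] unfolding unitary_mat_def by simp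
qed

text \<open>
  The columns of \<open>V\<close> are the normalised vectors of \<open>ws\<close>. The factor \<open>r j\<close> is the
  reciprocal of the norm of \<open>ws ! j\<close>.
\<close>

lemma unitary_mat_of_corthogonal:
  assumes orth: "corthogonal ws" and ws: "set ws \<subseteq> carrier_vec n" and len: "length ws = n"
  obtains V r where "unitary_mat n V"
    "\<And>i j. i < n \<Longrightarrow> j < n \<Longrightarrow> V $$ (i, j) = r j * ws ! j $ i"
proof -
  define c where "c j = sqrt (Re (ws ! j \<bullet>c ws ! j))" for j
  define V where "V = mat n n (\<lambda>(i, j). complex_of_real (1 / c j) * ws ! j $ i)"
  have wj: "ws ! j \<in> carrier_vec n" if "j < n" for j using ws len that by auto
  have cc: "complex_of_real (c j * c j) = ws ! j \<bullet>c ws ! j" "c j \<noteq> 0" if j: "j < n" for j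
  proof -
    have pos: "ws ! j \<bullet>c ws ! j \<ge> 0" by auto
    show *: "complex_of_real (c j * c j) = ws ! j \<bullet>c ws ! j"
      using pos unfolding c_def by (auto simp: less_eq_complex_def complex_eq_iff)
    have "ws ! j \<bullet>c ws ! j \<noteq> 0" using corthogonalD[OF orth, of j j] j len by simp
    then show "c j \<noteq> 0" using * by auto
  qed
  have "mat_adjoint V * V = 1\<^sub>m n"
  proof (rule eq_matI)
    fix i j assume "i < dim_row (1\<^sub>m n :: complex mat)" "j < dim_col (1\<^sub>m n :: complex mat)"
    then have i: "i < n" and j: "j < n" by auto
    have "(mat_adjoint V * V) $$ (i, j) = (\<Sum>k<n. cnj (V $$ (k, i)) * V $$ (k, j))"
      using i j unfolding V_def by (simp add: scalar_prod_def atLeast0LessThan)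
    also have "\<dots> = complex_of_real (1 / (c i * c j)) * (ws ! j \<bullet>c ws ! i)"
      using i j wj[OF i] wj[OF j] unfolding V_def
      by (auto simp: scalar_prod_def atLeast0LessThan sum_distrib_left sum_divide_distrib intro!: sum.cong)
    also have "\<dots> = (if i = j then 1 else 0)"
      using cc[OF i] corthogonalD[OF orth, of j i] i j len
      by (auto simp flip: cc(1))
    finally show "(mat_adjoint V * V) $$ (i, j) = 1\<^sub>m n $$ (i, j)"
      using i j by simp
  qed (auto simp: V_def)
  then have "unitary_mat n V" unfolding unitary_mat_def V_def by simp
  then show thesis by (rule that[of _ "\<lambda>j. complex_of_real (1 / c j)"]) (simp add: V_def)
qed

text \<open>
  The elimination step of the QR decomposition. If \<open>a \<noteq> 0\<close>, complete \<open>a\<close> to an orthogonal basis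
  with \<open>a\<close> as first vector and let \<open>V\<close> have the normalised basis as columns. Entry \<open>i\<close> of
  \<open>V\<^sup>H a\<close> is then a multiple of the inner product of \<open>a\<close> with the \<open>i\<close>-th basis vector, which
  vanishes for \<open>i > 0\<close>.
\<close>

lemma unitary_annihilates_tail:
  assumes a: "a \<in> carrier_vec n"
  obtains V where "unitary_mat n V" "\<And>i. 0 < i \<Longrightarrow> i < n \<Longrightarrow> (mat_adjoint V *\<^sub>v a) $ i = 0"
proof (cases "a = 0\<^sub>v n")
  case True
  show thesis
    by (rule that[OF unitary_mat_one]) (auto simp: True)
next
  case False
  interpret cof_vec_space n "TYPE(complex)" .
  define bs where "bs = basis_completion a"
  note b = basis_completion[OF a False, folded bs_def]
  define ws where "ws = gram_schmidt n bs"
  note w = gram_schmidt_result[OF b(2) b(4) b(5) ws_def]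
  have n: "n > 0" using a False by (cases n) auto
  have bs: "bs = a # tl bs" using b(6,7) n by (cases bs) auto
  have "hd ws = a" unfolding ws_def by (subst bs) (rule gram_schmidt_hd[OF a])
  then have w0: "ws ! 0 = a" using w(4) b(6) n by (simp add: hd_conv_nth flip: length_greater_0_conv)
  obtain V r where V: "unitary_mat n V"
      "\<And>i j. i < n \<Longrightarrow> j < n \<Longrightarrow> V $$ (i, j) = r j * ws ! j $ i"
    using unitary_mat_of_corthogonal[OF w(2,3)] w(4) b(6) by auto
  show thesis
  proof (rule that[OF V(1)])
    fix i assume i: "0 < i" "i < n"
    have wi: "ws ! i \<in> carrier_vec n" using w(3,4) b(6) i by auto
    have "(mat_adjoint V *\<^sub>v a) $ i = cnj (r i) * (a \<bullet>c ws ! i)"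
      using unitary_matD(1)[OF V(1)] i a wi
      by (auto simp: scalar_prod_def V(2) sum_distrib_left intro!: sum.cong)
    also have "a \<bullet>c ws ! i = 0" using corthogonalD[OF w(2), of 0 i] w(4) b(6) i n w0 by simp
    finally show "(mat_adjoint V *\<^sub>v a) $ i = 0" by simp
  qed
qed

text \<open>
  Induction on the number of rows. A unitary \<open>V\<close> clears the first column of \<open>A\<close> below the diagonal,
  leaving \<open>V\<^sup>H A\<close> with blocks \<open>B1\<close>, \<open>B2\<close> over \<open>0\<close>, \<open>B4\<close>. The induction hypothesis factors the
  smaller block \<open>B4\<close> as \<open>Q' R'\<close>, and \<open>V diag(1, Q')\<close> is the unitary factor for \<open>A\<close>.
\<close>

lemma QR_exists:
  fixes A :: "complex mat"
  assumes "A \<in> carrier_mat m n"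
  shows "\<exists>Q R. unitary_mat m Q \<and> R \<in> carrier_mat m n \<and>
    (\<forall>i<m. \<forall>j<n. j < i \<longrightarrow> R $$ (i, j) = 0) \<and> A = Q * R"
  using assms
proof (induction m arbitrary: n A)
  case 0
  then show ?case using unitary_mat_one[of 0] by (intro exI[of _ "1\<^sub>m 0"] exI[of _ A]) auto
next
  case (Suc m)
  note A = Suc.prems
  show ?case
  proof (cases n)
    case 0
    then show ?thesis using A unitary_mat_one[of "Suc m"]
      by (intro exI[of _ "1\<^sub>m (Suc m)"] exI[of _ A]) auto
  next
    case (Suc n')
    have "col A 0 \<in> carrier_vec (Suc m)" by (rule carrier_vecI) (use A in simp)
    then obtain V where V: "unitary_mat (Suc m) V"
      and tail: "\<And>i. 0 < i \<Longrightarrow> i < Suc m \<Longrightarrow> (mat_adjoint V *\<^sub>v col A 0) $ i = 0"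
      using unitary_annihilates_tail by blast
    note v = unitary_matD[OF V]
    define B where "B = mat_adjoint V * A"
    have B: "B \<in> carrier_mat (Suc m) (Suc n')" using v(1) A Suc unfolding B_def by auto
    obtain B1 B2 B3 B4 where split: "split_block B 1 1 = (B1, B2, B3, B4)"
      by (cases "split_block B 1 1")
    note b = split_block[OF split, of m n']
    have b': "B1 \<in> carrier_mat 1 1" "B2 \<in> carrier_mat 1 n'" "B3 \<in> carrier_mat m 1"
      "B4 \<in> carrier_mat m n'" and Bb: "B = four_block_mat B1 B2 B3 B4"
      using b B by auto
    have B3: "B3 = 0\<^sub>m m 1"
    proof (rule eq_matI)
      fix i j assume "i < dim_row (0\<^sub>m m 1 :: complex mat)" "j < dim_col (0\<^sub>m m 1 :: complex mat)"
      then have i: "i < m" and j: "j = 0" by auto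
      have "B3 $$ (i, j) = B $$ (Suc i, 0)" using i j b' unfolding Bb by simp
      also have "\<dots> = (mat_adjoint V *\<^sub>v col A 0) $ Suc i"
        unfolding B_def using i v(1) A Suc by auto
      finally show "B3 $$ (i, j) = 0\<^sub>m m 1 $$ (i, j)" using tail[of "Suc i"] i j by simp
    qed (use b' in auto)
    obtain Q' R' where Q': "unitary_mat m Q'" and R': "R' \<in> carrier_mat m n'"
      and up: "\<And>i j. i < m \<Longrightarrow> j < n' \<Longrightarrow> j < i \<Longrightarrow> R' $$ (i, j) = 0" and B4: "B4 = Q' * R'"
      using Suc.IH[OF b'(4)] by blast
    note q' = unitary_matD[OF Q']
    define P where "P = four_block_mat (1\<^sub>m 1) (0\<^sub>m 1 m) (0\<^sub>m m 1) Q'"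
    define R where "R = four_block_mat B1 B2 (0\<^sub>m m 1) R'"
    have P: "unitary_mat (Suc m) P" unfolding P_def by (rule unitary_mat_block[OF Q'])
    have R: "R \<in> carrier_mat (Suc m) n"
      using four_block_carrier_mat[OF b'(1) R'] Suc unfolding R_def by simp
    have PR: "P * R = B"
      unfolding P_def R_def Bb B3 B4
      by (subst mult_four_block_mat[of _ 1 1 _ m _ m _ _ 1 _ n']) (use q'(1) R' b' in auto)
    have "V * P * R = V * (P * R)"
      by (rule assoc_mult_mat) (use v(1) unitary_matD(1)[OF P] R in auto)
    also have "\<dots> = V * mat_adjoint V * A" unfolding PR B_def
      by (rule assoc_mult_mat[symmetric]) (use v(1) A in auto)
    also have "\<dots> = A" using v(3) A by simp
    finally have "A = V * P * R" by simp
    moreover have "R $$ (i, j) = 0" if "i < Suc m" "j < n" "j < i" for i j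
      using that up[of "i - 1" "j - 1"] b' R' Suc unfolding R_def by (cases j) auto
    ultimately show ?thesis
      by (intro exI[of _ "V * P"] exI[of _ R] conjI unitary_mat_mult[OF V P] R) simp_all
  qed
qed

section \<open>Invertibility of the transformation matrix\<close>

text \<open>
  By the product formula \<open>2 sin x cos ((2k+1)x) = sin (2(k+1)x) - sin (2kx)\<close>, the sum telescopes.
\<close>

lemma sum_cos_odd_multiples:
  fixes n :: nat
  shows "2 * sin x * (\<Sum>k<n. cos ((2 * real k + 1) * x)) = sin (2 * real n * x)"
proof (induction n)
  case (Suc n)
  have "2 * sin x * cos ((2 * real n + 1) * x) = sin (2 * real (Suc n) * x) - sin (2 * real n * x)"
    using sin_times_cos[of x "(2 * real n + 1) * x"] sin_minus[of "2 * real n * x"]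
    by (simp add: algebra_simps)
  with Suc show ?case by (simp add: algebra_simps)
qed simp

text \<open>
  With \<open>x = t\<pi>/(2n)\<close> the telescoped sum is \<open>sin (t\<pi>) = 0\<close>, and the hypotheses on \<open>t\<close> say that
  \<open>0 < \<bar>x\<bar> < \<pi>\<close>, so the factor \<open>sin x\<close> can be cancelled.
\<close>

lemma sum_cos_dct:
  fixes t :: int
  assumes "t \<noteq> 0" "\<bar>t\<bar> < 2 * int n"
  shows "(\<Sum>k<n. cos (of_int t * (2 * real k + 1) * pi / (2 * real n))) = 0"
proof -
  define x where "x = of_int t * pi / (2 * real n)"
  have n: "n > 0" using assms by auto
  have tn: "\<bar>of_int t\<bar> < 2 * real n" using assms(2) by linarith
  have "\<bar>x\<bar> < pi" using tn n unfolding x_def by (simp add: abs_mult field_simps)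
  moreover have "x \<noteq> 0" using assms n unfolding x_def by simp
  ultimately have sx: "sin x \<noteq> 0"
    using sin_gt_zero[of x] sin_gt_zero[of "-x"] by (cases "x > 0") auto
  have "2 * real n * x = of_int t * pi" using n unfolding x_def by simp
  then have "2 * sin x * (\<Sum>k<n. cos ((2 * real k + 1) * x)) = 0"
    unfolding sum_cos_odd_multiples by (simp add: sin_zero_iff_int2)
  then have "(\<Sum>k<n. cos ((2 * real k + 1) * x)) = 0" using sx by simp
  then show ?thesis unfolding x_def by (simp add: mult_ac)
qed

text \<open>
  Writing a product of two cosines as half the sum of the cosines of the difference and of the sum of
  their angles reduces the inner product of rows \<open>i\<close> and \<open>j\<close> to a multiple of
  \<open>S (i - j) + S (i + j)\<close>, where \<open>S t\<close> is the sum in \<open>sum_cos_dct\<close>. Both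
  arguments lie strictly between \<open>-2n\<close> and \<open>2n\<close>, so only \<open>t = 0\<close> contributes. It occurs
  twice for \<open>i = j = 0\<close> but once for \<open>i = j > 0\<close>; the smaller weight of the first row compensates
  for this.
\<close>

lemma dct_mat_orthogonal: "dct_mat n * transpose_mat (dct_mat n) = 1\<^sub>m n"
proof (rule eq_matI)
  fix i j assume "i < dim_row (1\<^sub>m n :: complex mat)" "j < dim_col (1\<^sub>m n :: complex mat)"
  then have i: "i < n" and j: "j < n" by auto
  define s where "s i = sqrt ((2 - (if i = 0 then 1 else 0)) / real n)" for i :: nat
  define S where "S t = (\<Sum>k<n. cos (of_int t * (2 * real k + 1) * pi / (2 * real n)))" for t :: int
  have S: "S t = (if t = 0 then real n else 0)" if "\<bar>t\<bar> < 2 * int n" for t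
    using sum_cos_dct[of t n] that unfolding S_def by auto
  have "(dct_mat n * transpose_mat (dct_mat n)) $$ (i, j) = complex_of_real (\<Sum>k<n.
      (s i * cos (real i * (2 * real k + 1) * pi / (2 * real n))) *
      (s j * cos (real j * (2 * real k + 1) * pi / (2 * real n))))"
    using i j by (auto simp: dct_mat_def scalar_prod_def atLeast0LessThan s_def intro!: sum.cong)
  also have "(\<Sum>k<n. (s i * cos (real i * (2 * real k + 1) * pi / (2 * real n))) *
      (s j * cos (real j * (2 * real k + 1) * pi / (2 * real n)))) =
      s i * s j / 2 * (S (int i - int j) + S (int i + int j))"
    unfolding S_def sum.distrib[symmetric] sum_distrib_left
    by (intro sum.cong refl) (simp add: cos_times_cos algebra_simps add_divide_distrib diff_divide_distrib)
  also have "\<dots> = (if i = j then 1 else 0)"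
    using i j by (auto simp: S s_def)
  finally show "(dct_mat n * transpose_mat (dct_mat n)) $$ (i, j) = 1\<^sub>m n $$ (i, j)"
    using i j by simp
qed (auto simp: dct_mat_def)

text \<open>
  The angles in the first column of the DCT matrix are \<open>j\<pi>/(2n)\<close> with \<open>j < n\<close>, hence all below
  \<open>\<pi>/2\<close>, where the cosine is positive.
\<close>

lemma det_W_mat: "det (W_mat n) \<noteq> 0"
proof -
  have "dct_mat n $$ (j, 0) \<noteq> 0" if j: "j < n" for j
  proof -
    have "real j * (2 * real 0 + 1) * pi / (2 * real n) < pi / 2"
      using j by (simp add: field_simps)
    moreover have "0 \<le> real j * (2 * real 0 + 1) * pi / (2 * real n)" by simp
    ultimately have "cos (real j * (2 * real 0 + 1) * pi / (2 * real n)) > 0"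
      by (intro cos_gt_zero_pi) (auto intro: less_le_trans[of _ 0])
    then show ?thesis using j unfolding dct_mat_def by auto
  qed
  moreover have "det (W_mat n) = prod_list (diag_mat (W_mat n))"
    by (rule det_upper_triangular[of _ n]) (auto simp: W_mat_def mat_diag_def)
  ultimately show ?thesis
    by (auto simp: diag_mat_def W_mat_def mat_diag_def)
qed

lemma M_mat_inverse:
  obtains N where "M_mat n \<in> carrier_mat n n" "N \<in> carrier_mat n n"
    "M_mat n * N = 1\<^sub>m n" "N * M_mat n = 1\<^sub>m n"
proof -
  have W: "W_mat n \<in> carrier_mat n n" unfolding W_mat_def by simp
  have C: "dct_mat n \<in> carrier_mat n n" unfolding dct_mat_def by simp
  have Z: "1\<^sub>m n + Z_mat n \<in> carrier_mat n n" unfolding Z_mat_def by simp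
  \<comment> \<open>\<open>M_mat\<close> contains \<open>the (mat_inverse (W_mat n))\<close>, which is the inverse
    only once \<open>mat_inverse\<close> is known to succeed.\<close>
  obtain V where V: "mat_inverse (W_mat n) = Some V"
    using mat_inverse(1)[OF W, where b = "()"] det_non_zero_imp_unit[OF W det_W_mat, where b = "()"]
    by (cases "mat_inverse (W_mat n)") auto
  note v = mat_inverse(2)[OF W V]
  have "det (W_mat n) * det V = 1" using det_mult[OF W, of V] v by simp
  then have dV: "det V \<noteq> 0" by auto
  have "det (dct_mat n) * det (transpose_mat (dct_mat n)) = 1"
    using det_mult[OF C, of "transpose_mat (dct_mat n)"] dct_mat_orthogonal[of n] C by simp
  then have dC: "det (dct_mat n) \<noteq> 0" by auto
  have "det (1\<^sub>m n + Z_mat n) = prod_list (diag_mat (1\<^sub>m n + Z_mat n))"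
    by (rule det_upper_triangular[OF _ Z]) (auto simp: Z_mat_def)
  then have dZ: "det (1\<^sub>m n + Z_mat n) \<noteq> 0"
    by (auto simp: diag_mat_def Z_mat_def)
  have M: "M_mat n = V * dct_mat n * (1\<^sub>m n + Z_mat n)" unfolding M_mat_def V by simp
  have Mc: "M_mat n \<in> carrier_mat n n" unfolding M using v C Z by auto
  have "det (M_mat n) = det V * det (dct_mat n) * det (1\<^sub>m n + Z_mat n)"
    unfolding M using v det_mult[OF _ Z, of "V * dct_mat n"] det_mult[OF _ C, of V]
      mult_carrier_mat[OF _ C, of V] by simp
  then have "det (M_mat n) \<noteq> 0" using dV dC dZ by simp
  from det_non_zero_imp_unit[OF Mc this, of "()"] obtain N where
    "N \<in> carrier_mat n n" "N * M_mat n = 1\<^sub>m n" "M_mat n * N = 1\<^sub>m n"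
    unfolding Units_def ring_mat_def by auto
  with Mc show thesis by (intro that)
qed

section \<open>The transformation as a bijection on tensors\<close>

text \<open>
  The mode-3 product of a tensor with a matrix: every tube \<open>A(i, j, :)\<close> is multiplied by \<open>P\<close>. The
  slice dimensions are parameters because they cannot be read off a tensor without slices.
\<close>

definition mode3 :: "complex mat \<Rightarrow> nat \<Rightarrow> nat \<Rightarrow> tensor \<Rightarrow> tensor" where
  "mode3 P a b A = map (\<lambda>k. mat a b (\<lambda>(i, j). \<Sum>l<length A. P $$ (k, l) * A ! l $$ (i, j)))
     [0..<length A]"

lemma tensors_iff: "A \<in> tensors a b n \<longleftrightarrow> length A = n \<and> (\<forall>k<n. A ! k \<in> carrier_mat a b)"
  unfolding tensors_def by (auto simp: set_conv_nth)

lemma tdim_tensors: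
  assumes "A \<in> tensors a b n" "n > 0"
  shows "tdim1 A = a" "tdim2 A = b" "length A = n"
  using assms unfolding tensors_iff tdim1_def tdim2_def by auto

lemma mode3_tensors: "A \<in> tensors a b n \<Longrightarrow> mode3 P a b A \<in> tensors a b n"
  unfolding tensors_iff mode3_def by auto

lemma mode3_index:
  assumes "A \<in> tensors a b n" "k < n" "i < a" "j < b"
  shows "mode3 P a b A ! k $$ (i, j) = (\<Sum>l<n. P $$ (k, l) * A ! l $$ (i, j))"
  using assms unfolding tensors_iff mode3_def by simp

lemma tensor_eqI:
  assumes "A \<in> tensors a b n" "B \<in> tensors a b n"
    and "\<And>k i j. k < n \<Longrightarrow> i < a \<Longrightarrow> j < b \<Longrightarrow> A ! k $$ (i, j) = B ! k $$ (i, j)"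
  shows "A = B"
proof (rule nth_equalityI)
  show "length A = length B" using assms unfolding tensors_iff by simp
next
  fix k assume "k < length A"
  then have k: "k < n" using assms unfolding tensors_iff by simp
  then have "A ! k \<in> carrier_mat a b" "B ! k \<in> carrier_mat a b"
    using assms(1,2) unfolding tensors_iff by auto
  then show "A ! k = B ! k" using assms(3)[OF k] by (intro eq_matI) auto
qed

lemma mode3_inverse:
  assumes P: "P \<in> carrier_mat n n" and S: "S \<in> carrier_mat n n" and PS: "P * S = 1\<^sub>m n"
    and A: "A \<in> tensors a b n"
  shows "mode3 P a b (mode3 S a b A) = A"
proof (rule tensor_eqI[of _ a b n])
  show "mode3 P a b (mode3 S a b A) \<in> tensors a b n" by (intro mode3_tensors A)
  show "A \<in> tensors a b n" by (rule A)
  fix k i j assume k: "k < n" and i: "i < a" and j: "j < b"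
  have "mode3 P a b (mode3 S a b A) ! k $$ (i, j) =
      (\<Sum>l<n. P $$ (k, l) * (\<Sum>m<n. S $$ (l, m) * A ! m $$ (i, j)))"
    using i j by (simp add: mode3_index[OF mode3_tensors[OF A] k] mode3_index[OF A])
  also have "\<dots> = (\<Sum>m<n. \<Sum>l<n. P $$ (k, l) * S $$ (l, m) * A ! m $$ (i, j))"
    unfolding sum_distrib_left by (subst sum.swap) (simp add: mult_ac)
  also have "\<dots> = (\<Sum>m<n. (P * S) $$ (k, m) * A ! m $$ (i, j))"
    using P S k by (intro sum.cong refl)
      (auto simp: scalar_prod_def atLeast0LessThan sum_distrib_right)
  also have "\<dots> = (\<Sum>m<n. if m = k then A ! m $$ (i, j) else 0)"
    using k unfolding PS by (intro sum.cong) auto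
  also have "\<dots> = A ! k $$ (i, j)" using k by simp
  finally show "mode3 P a b (mode3 S a b A) ! k $$ (i, j) = A ! k $$ (i, j)" .
qed

lemma L_map_eq_mode3:
  assumes "A \<in> tensors a b n" "n > 0"
  shows "L_map A = mode3 (M_mat n) a b A"
  unfolding L_map_def mode3_def tdim_tensors[OF assms] ..

lemma L_map_carrier:
  assumes "A \<in> tensors a b n" "k < n"
  shows "L_map A ! k \<in> carrier_mat a b"
  using assms mode3_tensors[OF assms(1), of "M_mat n"] L_map_eq_mode3[OF assms(1)]
  by (auto simp: tensors_iff)

text \<open>
  This gives the uniqueness in the definite descriptions behind the C-product, the conjugate
  transpose and the identity tensor.
\<close>

lemma L_map_inj:
  assumes A: "A \<in> tensors a b n" and B: "B \<in> tensors a b n"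
    and eq: "\<And>k. k < n \<Longrightarrow> L_map A ! k = L_map B ! k"
  shows "A = B"
proof (cases "n = 0")
  case True
  then show ?thesis using A B by (simp add: tensors_iff)
next
  case False
  then have n: "n > 0" by simp
  obtain N where N: "M_mat n \<in> carrier_mat n n" "N \<in> carrier_mat n n" "N * M_mat n = 1\<^sub>m n"
    using M_mat_inverse by blast
  have "L_map A = L_map B"
    by (rule nth_equalityI) (use A B eq in \<open>auto simp: L_map_def tensors_iff\<close>)
  then have "mode3 N a b (mode3 (M_mat n) a b A) = mode3 N a b (mode3 (M_mat n) a b B)"
    by (simp add: L_map_eq_mode3[OF A n] L_map_eq_mode3[OF B n])
  then show ?thesis using mode3_inverse[OF N(2,1,3)] A B by simp
qed

text \<open>
  The preimage is the mode-3 product of \<open>X\<close> with the inverse of \<open>M_mat n\<close>. Its slices are linear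
  combinations of the \<open>X k\<close>, so a position where all \<open>X k\<close> vanish is also zero in every slice of the
  preimage. This last property is what carries triangularity from the transformed slices back to
  the tensor itself.
\<close>

lemma L_map_surj:
  assumes X: "\<And>k. k < n \<Longrightarrow> X k \<in> carrier_mat a b"
  shows "\<exists>B. B \<in> tensors a b n \<and> (\<forall>k<n. L_map B ! k = X k) \<and>
    (\<forall>i<a. \<forall>j<b. (\<forall>k<n. X k $$ (i, j) = 0) \<longrightarrow> (\<forall>k<n. B ! k $$ (i, j) = 0))"
proof -
  obtain N where N: "M_mat n \<in> carrier_mat n n" "N \<in> carrier_mat n n" "M_mat n * N = 1\<^sub>m n"
    using M_mat_inverse by blast
  define Y where "Y = map X [0..<n]"
  have Y: "Y \<in> tensors a b n" using X unfolding Y_def tensors_iff by auto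
  have nth_Y: "Y ! k = X k" if "k < n" for k using that unfolding Y_def by simp
  let ?B = "mode3 N a b Y"
  have B: "?B \<in> tensors a b n" by (rule mode3_tensors[OF Y])
  have "L_map ?B ! k = X k" if k: "k < n" for k
  proof -
    have "L_map ?B = Y"
      using k L_map_eq_mode3[OF B] mode3_inverse[OF N Y] by simp
    then show ?thesis using nth_Y[OF k] by simp
  qed
  moreover have "?B ! k $$ (i, j) = 0"
    if "i < a" "j < b" "\<forall>k<n. X k $$ (i, j) = 0" "k < n" for i j k
    using that by (simp add: mode3_index[OF Y] nth_Y)
  ultimately show ?thesis using B by blast
qed

text \<open>
  For tensors without slices the dimensions \<open>tdim1\<close> and \<open>tdim2\<close> are unspecified, but then \<open>[]\<close> is
  the only tensor of any size; this is why the case \<open>n = 0\<close> is treated apart here and for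
  the conjugate transpose.
\<close>

lemma c_product_eqI:
  assumes A: "A \<in> tensors a m n" and B: "B \<in> tensors m b n" and C: "C \<in> tensors a b n"
    and eq: "\<And>k. k < n \<Longrightarrow> L_map C ! k = L_map A ! k * L_map B ! k"
  shows "A *\<^sub>c B = C"
proof (cases "n = 0")
  case True
  then show ?thesis using A B C unfolding c_product_def tensors_iff
    by (intro the_equality) auto
next
  case False
  then show ?thesis
    using tdim_tensors[OF A] tdim_tensors[OF B] C eq unfolding c_product_def
    by (intro the_equality) (auto intro: L_map_inj)
qed

lemma conj_transpose_eqI:
  assumes A: "A \<in> tensors a b n" and B: "B \<in> tensors b a n"
    and eq: "\<And>k. k < n \<Longrightarrow> L_map B ! k = mat_adjoint (L_map A ! k)"
  shows "conj_transpose A = B"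
proof (cases "n = 0")
  case True
  then show ?thesis using A B unfolding conj_transpose_def tensors_iff
    by (intro the_equality) auto
next
  case False
  then show ?thesis
    using tdim_tensors[OF A] B eq unfolding conj_transpose_def
    by (intro the_equality) (auto intro: L_map_inj)
qed

lemma identity_tensor_eqI:
  assumes B: "B \<in> tensors a a n" and eq: "\<And>k. k < n \<Longrightarrow> L_map B ! k = 1\<^sub>m a"
  shows "identity_tensor a n = B"
  using B eq unfolding identity_tensor_def by (intro the_equality) (auto intro: L_map_inj)

section \<open>The tensor QR decomposition\<close>

lemma unitary_tensorI:
  assumes Q: "Q \<in> tensors m m n" and U: "\<And>k. k < n \<Longrightarrow> unitary_mat m (L_map Q ! k)"
  shows "unitary_tensor m n Q"
proof -
  obtain H where H: "H \<in> tensors m m n" "\<And>k. k < n \<Longrightarrow> L_map H ! k = mat_adjoint (L_map Q ! k)"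
    using L_map_surj[of n "\<lambda>k. mat_adjoint (L_map Q ! k)", OF mat_adjoint_carrier[OF L_map_carrier[OF Q]]]
    by blast
  obtain I where I: "I \<in> tensors m m n" "\<And>k. k < n \<Longrightarrow> L_map I ! k = 1\<^sub>m m"
    using L_map_surj[of n "\<lambda>k. 1\<^sub>m m", OF one_carrier_mat] by blast
  have "conj_transpose Q = H" by (rule conj_transpose_eqI[OF Q H])
  moreover have "identity_tensor m n = I" by (rule identity_tensor_eqI[OF I])
  moreover have "H *\<^sub>c Q = I"
    by (rule c_product_eqI[OF H(1) Q I(1)]) (simp add: H(2) I(2) unitary_matD[OF U])
  moreover have "Q *\<^sub>c H = I"
    by (rule c_product_eqI[OF Q H(1) I(1)]) (simp add: H(2) I(2) unitary_matD[OF U])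
  ultimately show ?thesis using Q unfolding unitary_tensor_def by simp
qed

theorem theorem3p4:
  fixes A :: tensor and n1 n2 n3 :: nat
  assumes "A \<in> tensors n1 n2 n3"
  shows "\<exists>Q R. unitary_tensor n1 n3 Q \<and> R \<in> tensors n1 n2 n3 \<and> F_upper R \<and> A = Q *\<^sub>c R"
proof -
  have "\<forall>k. \<exists>U T. k < n3 \<longrightarrow> unitary_mat n1 U \<and> T \<in> carrier_mat n1 n2 \<and>
      (\<forall>i<n1. \<forall>j<n2. j < i \<longrightarrow> T $$ (i, j) = 0) \<and> L_map A ! k = U * T"
    using QR_exists[OF L_map_carrier[OF assms]] by blast
  then obtain U T where U: "\<And>k. k < n3 \<Longrightarrow> unitary_mat n1 (U k)"
    and T: "\<And>k. k < n3 \<Longrightarrow> T k \<in> carrier_mat n1 n2"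
    and up: "\<And>k i j. k < n3 \<Longrightarrow> i < n1 \<Longrightarrow> j < n2 \<Longrightarrow> j < i \<Longrightarrow> T k $$ (i, j) = 0"
    and UT: "\<And>k. k < n3 \<Longrightarrow> L_map A ! k = U k * T k"
    by metis
  obtain Q where Q: "Q \<in> tensors n1 n1 n3" "\<And>k. k < n3 \<Longrightarrow> L_map Q ! k = U k"
    using L_map_surj[of n3 U, OF unitary_matD(1)[OF U]] by blast
  obtain R where R: "R \<in> tensors n1 n2 n3" "\<And>k. k < n3 \<Longrightarrow> L_map R ! k = T k"
    and R0: "\<And>i j. i < n1 \<Longrightarrow> j < n2 \<Longrightarrow> \<forall>k<n3. T k $$ (i, j) = 0 \<Longrightarrow>
      \<forall>k<n3. R ! k $$ (i, j) = 0"
    using L_map_surj[of n3 T, OF T] by blast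
  have "unitary_tensor n1 n3 Q" by (rule unitary_tensorI[OF Q(1)]) (simp add: Q(2) U)
  moreover have "F_upper R"
    unfolding F_upper_def
  proof (intro ballI allI impI)
    fix S i j assume S: "S \<in> set R" and i: "i < dim_row S" and j: "j < dim_col S" and ji: "j < i"
    obtain k where k: "k < n3" "S = R ! k" using S R(1) by (auto simp: tensors_iff in_set_conv_nth)
    with R(1) have "S \<in> carrier_mat n1 n2" by (auto simp: tensors_iff)
    then have "i < n1" "j < n2" using i j by auto
    with R0[OF this] up ji k show "S $$ (i, j) = 0" by auto
  qed
  moreover have "Q *\<^sub>c R = A"
    by (rule c_product_eqI[OF Q(1) R(1) assms]) (simp add: Q(2) R(2) UT)
  ultimately show ?thesis using R(1) by blast
qed

end
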